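(* Let $f:R\to R'$ be a homomorphism of commutative rings with unity, $X\subseteq\mathrm{Spec}(R)$ and $Y\subseteq\mathrm{Spec}(R')$. Then $f^{-1}(J)$ is a strong $\mathcal{H}_X$-ideal of $R$ for every strong $\mathcal{H}_Y$-ideal $J$ of $R'$ if and only if $f^{-1}(P)$ is a strong $\mathcal{H}_X$-ideal of $R$ for every $P\in Y$. Likewise, $f^{-1}(J)$ is an $\mathcal{H}_X$-ideal for every $\mathcal{H}_Y$-ideal $J$ of $R'$ if and only if $f^{-1}(P)$ is an $\mathcal{H}_X$-ideal for every $P\in Y$; and $f^{-1}(J)$ is an $X$-Hilbert ideal for every $Y$-Hilbert ideal $J$ of $R'$ if and only if $f^{-1}(P)$ is an $X$-Hilbert ideal for every $P\in Y$.
   Context: For a commutative ring $T$, $Z\subseteq\mathrm{Spec}(T)$ and $S\subseteq T$: $h_Z(S)=\{P\in Z: S\subseteq P\}$, $h_Z(a)=h_Z(\{a\})$, and for $W\subseteq Z$, $k(W)=\bigcap_{P\in W}P$ (with $k(\emptyset)=T$); $kh_Z(S)=k(h_Z(S))$. An ideal $I$ of $T$ (not necessarily proper) is an $\mathcal{H}_Z$-ideal if $a\in I$, $b\in T$ and $h_Z(a)\subseteq h_Z(b)$ imply $b\in I$. It is a strong $\mathcal{H}_Z$-ideal if for every finite subset $F\subseteq I$ and every $b\in T$, $h_Z(F)\subseteq h_Z(b)$ implies $b\in I$. It is a $Z$-Hilbert ideal if $I=kh_Z(I)$. Ring homomorphisms preserve unity. *)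

theory Defs
  imports "HOL-Algebra.QuotRing"
begin

definition Spec :: "('a, 'm) ring_scheme \<Rightarrow> 'a set set" where
  "Spec T = {P. primeideal P T}"

definition hZ :: "'a set set \<Rightarrow> 'a set \<Rightarrow> 'a set set" where
  "hZ Z S = {P \<in> Z. S \<subseteq> P}"

(* Intersecting with the carrier gives kZ T {} = carrier T, not UNIV. *)
definition kZ :: "('a, 'm) ring_scheme \<Rightarrow> 'a set set \<Rightarrow> 'a set" where
  "kZ T W = carrier T \<inter> \<Inter> W"

(* In the three notions below I need not be proper; Z is intended to be a subset of Spec T. *)

definition H_ideal :: "('a, 'm) ring_scheme \<Rightarrow> 'a set set \<Rightarrow> 'a set \<Rightarrow> bool" where
  "H_ideal T Z I \<longleftrightarrow> ideal I T \<and>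
     (\<forall>a\<in>I. \<forall>b\<in>carrier T. hZ Z {a} \<subseteq> hZ Z {b} \<longrightarrow> b \<in> I)"

definition strong_H_ideal :: "('a, 'm) ring_scheme \<Rightarrow> 'a set set \<Rightarrow> 'a set \<Rightarrow> bool" where
  "strong_H_ideal T Z I \<longleftrightarrow> ideal I T \<and>
     (\<forall>F. finite F \<and> F \<subseteq> I \<longrightarrow>
        (\<forall>b\<in>carrier T. hZ Z F \<subseteq> hZ Z {b} \<longrightarrow> b \<in> I))"

definition Hilbert_ideal :: "('a, 'm) ring_scheme \<Rightarrow> 'a set set \<Rightarrow> 'a set \<Rightarrow> bool" where
  "Hilbert_ideal T Z I \<longleftrightarrow> ideal I T \<and> I = kZ T (hZ Z I)"

end

(* Every P in Y is itself an ideal of each of the three kinds, which gives the forward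
   implications. Conversely, each kind of ideal is cut out by conditions on the members of Y,
   and the hypothesis on the preimages of those members transfers the conditions from X to Y
   one prime at a time. *)
theory Submission
  imports Defs
begin

lemma Spec_ideal: "P \<in> Spec T \<Longrightarrow> ideal P T"
  by (simp add: Spec_def primeideal.axioms(1))

lemma strong_H_idealD:
  "\<lbrakk>strong_H_ideal T Z I; finite F; F \<subseteq> I; b \<in> carrier T; hZ Z F \<subseteq> hZ Z {b}\<rbrakk> \<Longrightarrow> b \<in> I"
  by (simp add: strong_H_ideal_def)

lemma H_idealD:
  "\<lbrakk>H_ideal T Z I; a \<in> I; b \<in> carrier T; hZ Z {a} \<subseteq> hZ Z {b}\<rbrakk> \<Longrightarrow> b \<in> I"
  unfolding H_ideal_def by blast

lemma Hilbert_idealD: "Hilbert_ideal T Z I \<Longrightarrow> kZ T (hZ Z I) = I"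
  by (simp add: Hilbert_ideal_def)

text \<open>\<open>P\<close> is its own witness: if \<open>F\<close> lies in \<open>P\<close>, then
  \<open>P\<close> belongs to \<open>hZ Z F\<close>, hence to \<open>hZ Z {b}\<close>, which says
  that \<open>b\<close> is in \<open>P\<close>.\<close>

lemma strong_H_ideal_member: "\<lbrakk>Z \<subseteq> Spec T; P \<in> Z\<rbrakk> \<Longrightarrow> strong_H_ideal T Z P"
  unfolding strong_H_ideal_def hZ_def by (auto intro: Spec_ideal)

lemma H_ideal_member: "\<lbrakk>Z \<subseteq> Spec T; P \<in> Z\<rbrakk> \<Longrightarrow> H_ideal T Z P"
  unfolding H_ideal_def hZ_def by (auto intro: Spec_ideal)

lemma subset_kZ_hZ: "I \<subseteq> carrier T \<Longrightarrow> I \<subseteq> kZ T (hZ Z I)"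
  by (auto simp: kZ_def hZ_def)

lemma kZ_hZ_mono: "I \<subseteq> I' \<Longrightarrow> kZ T (hZ Z I) \<subseteq> kZ T (hZ Z I')"
  by (auto simp: kZ_def hZ_def)

text \<open>Reduces the Hilbert equation to one inclusion; the other holds for every subset of the
  carrier.\<close>

lemma Hilbert_idealI:
  assumes "ideal I T" "kZ T (hZ Z I) \<subseteq> I"
  shows "Hilbert_ideal T Z I"
  unfolding Hilbert_ideal_def
  using assms by (intro conjI subset_antisym subset_kZ_hZ) (auto dest: ideal.Icarr)

text \<open>\<open>P\<close> occurs in the family \<open>hZ Z P\<close>, so the intersection of that
  family lies in \<open>P\<close>.\<close>

lemma Hilbert_ideal_member: "\<lbrakk>Z \<subseteq> Spec T; P \<in> Z\<rbrakk> \<Longrightarrow> Hilbert_ideal T Z P"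
  by (rule Hilbert_idealI) (auto simp: Spec_ideal kZ_def hZ_def)

lemma (in ring_hom_ring) strong_H_ideal_preimage:
  assumes J: "strong_H_ideal S Y J"
    and Y: "\<And>P. P \<in> Y \<Longrightarrow> strong_H_ideal R X {r \<in> carrier R. h r \<in> P}"
  shows "strong_H_ideal R X {r \<in> carrier R. h r \<in> J}"
  unfolding strong_H_ideal_def
proof (intro conjI allI ballI impI)
  show "ideal {r \<in> carrier R. h r \<in> J} R"
    using J by (simp add: strong_H_ideal_def ideal_vimage)
next
  fix F b
  assume F: "finite F \<and> F \<subseteq> {r \<in> carrier R. h r \<in> J}"
    and b: "b \<in> carrier R" and sub: "hZ X F \<subseteq> hZ X {b}"
  \<comment> \<open>The inclusion over \<open>X\<close> is used separately for each
    \<open>P\<close>: it puts \<open>b\<close> into the preimage of \<open>P\<close> as soon as that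
    preimage contains \<open>F\<close>.\<close>
  have "h b \<in> P" if "P \<in> Y" "h ` F \<subseteq> P" for P
  proof -
    have "F \<subseteq> {r \<in> carrier R. h r \<in> P}"
      using F that by auto
    then show ?thesis
      using strong_H_idealD[OF Y[OF \<open>P \<in> Y\<close>] _ _ b sub] F by simp
  qed
  then have "hZ Y (h ` F) \<subseteq> hZ Y {h b}"
    by (auto simp: hZ_def)
  \<comment> \<open>The image of a finite set is finite, so the defining condition of
    \<open>J\<close> can be tested on it.\<close>
  moreover have "finite (h ` F)" "h ` F \<subseteq> J" "h b \<in> carrier S"
    using F b by auto
  ultimately have "h b \<in> J"
    using strong_H_idealD[OF J] by simp
  then show "b \<in> {r \<in> carrier R. h r \<in> J}"
    using b by simp
qed

text \<open>The argument for finite sets restricts to singletons, because \<open>h\<close> maps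
  \<open>{a}\<close> onto the singleton \<open>{h a}\<close>.\<close>

lemma (in ring_hom_ring) H_ideal_preimage:
  assumes J: "H_ideal S Y J"
    and Y: "\<And>P. P \<in> Y \<Longrightarrow> H_ideal R X {r \<in> carrier R. h r \<in> P}"
  shows "H_ideal R X {r \<in> carrier R. h r \<in> J}"
  unfolding H_ideal_def
proof (intro conjI ballI impI)
  show "ideal {r \<in> carrier R. h r \<in> J} R"
    using J by (simp add: H_ideal_def ideal_vimage)
next
  fix a b
  assume a: "a \<in> {r \<in> carrier R. h r \<in> J}"
    and b: "b \<in> carrier R" and sub: "hZ X {a} \<subseteq> hZ X {b}"
  have "h b \<in> P" if "P \<in> Y" "h a \<in> P" for P
    using H_idealD[OF Y[OF \<open>P \<in> Y\<close>] _ b sub] a that by simp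
  then have "hZ Y {h a} \<subseteq> hZ Y {h b}"
    by (auto simp: hZ_def)
  then have "h b \<in> J"
    using H_idealD[OF J, of "h a" "h b"] a b by simp
  then show "b \<in> {r \<in> carrier R. h r \<in> J}"
    using b by simp
qed

lemma (in ring_hom_ring) Hilbert_ideal_preimage:
  assumes J: "Hilbert_ideal S Y J"
    and Y: "\<And>P. P \<in> Y \<Longrightarrow> Hilbert_ideal R X {r \<in> carrier R. h r \<in> P}"
  shows "Hilbert_ideal R X {r \<in> carrier R. h r \<in> J}"
proof (rule Hilbert_idealI)
  show "ideal {r \<in> carrier R. h r \<in> J} R"
    using J by (simp add: Hilbert_ideal_def ideal_vimage)
next
  show "kZ R (hZ X {r \<in> carrier R. h r \<in> J}) \<subseteq> {r \<in> carrier R. h r \<in> J}"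
  proof
    fix b
    assume b: "b \<in> kZ R (hZ X {r \<in> carrier R. h r \<in> J})"
    then have carr: "b \<in> carrier R"
      by (simp add: kZ_def)
    have "h b \<in> P" if "P \<in> Y" "J \<subseteq> P" for P
    proof -
      \<comment> \<open>Enlarging an ideal leaves fewer members of \<open>X\<close> above it, so the
        intersection grows; thus \<open>b\<close> passes from the closure of the preimage of
        \<open>J\<close> to that of the preimage of \<open>P\<close>.\<close>
      have "{r \<in> carrier R. h r \<in> J} \<subseteq> {r \<in> carrier R. h r \<in> P}"
        using \<open>J \<subseteq> P\<close> by blast
      then have "b \<in> kZ R (hZ X {r \<in> carrier R. h r \<in> P})"
        using b kZ_hZ_mono by blast
      then show ?thesis
        using Hilbert_idealD[OF Y[OF \<open>P \<in> Y\<close>]] by simp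
    qed
    \<comment> \<open>\<open>carr\<close> supplies \<open>h b\<close> in \<open>carrier S\<close>,
      which is all that is asked when no member of \<open>Y\<close> contains
      \<open>J\<close>.\<close>
    then have "h b \<in> kZ S (hZ Y J)"
      using carr by (simp add: kZ_def hZ_def)
    then show "b \<in> {r \<in> carrier R. h r \<in> J}"
      using Hilbert_idealD[OF J] carr by simp
  qed
qed

theorem proposition6p2:
  fixes R :: "('a, 'm) ring_scheme"
    and R' :: "('b, 'n) ring_scheme"
    and f :: "'a \<Rightarrow> 'b"
    and X :: "'a set set"
    and Y :: "'b set set"
  assumes "cring R" and "cring R'"
    and "f \<in> ring_hom R R'"
    and "X \<subseteq> Spec R" and "Y \<subseteq> Spec R'"
  shows "((\<forall>J. strong_H_ideal R' Y J \<longrightarrow> strong_H_ideal R X {r \<in> carrier R. f r \<in> J})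
           \<longleftrightarrow> (\<forall>P\<in>Y. strong_H_ideal R X {r \<in> carrier R. f r \<in> P}))
       \<and> ((\<forall>J. H_ideal R' Y J \<longrightarrow> H_ideal R X {r \<in> carrier R. f r \<in> J})
           \<longleftrightarrow> (\<forall>P\<in>Y. H_ideal R X {r \<in> carrier R. f r \<in> P}))
       \<and> ((\<forall>J. Hilbert_ideal R' Y J \<longrightarrow> Hilbert_ideal R X {r \<in> carrier R. f r \<in> J})
           \<longleftrightarrow> (\<forall>P\<in>Y. Hilbert_ideal R X {r \<in> carrier R. f r \<in> P}))"
proof -
  interpret ring_hom_ring R R' f
    using assms by (simp add: ring_hom_ringI2 cring.axioms(1))
  note members = strong_H_ideal_member H_ideal_member Hilbert_ideal_member
  note preimages = strong_H_ideal_preimage H_ideal_preimage Hilbert_ideal_preimage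
  show ?thesis
    by (intro conjI iffI allI ballI impI)
      \<comment> \<open>The first alternative proves the forward implications by taking
        \<open>J\<close> to be \<open>P\<close>; the second proves the converses,
        \<open>bspec\<close> supplying the hypothesis on each \<open>P\<close> in
        \<open>Y\<close>.\<close>
      (erule allE, erule mp, erule members[OF \<open>Y \<subseteq> Spec R'\<close>] |
       erule preimages, erule bspec, assumption)+
qed

end
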